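(* Suppose $(X,\tau,<)$ is a GO-space with a monotone closure-preserving operator $r$. Then there is a convex open monotone operator $\mathring r$, i.e. a function assigning to every open cover $\mathcal U$ of $X$ a family $\mathring r(\mathcal U)$ of convex open subsets of $X$ refining $\mathcal U$ such that $\mathring r(\mathcal U)$ refines $\mathring r(\mathcal V)$ whenever $\mathcal U,\mathcal V$ are open covers of $X$ and $\mathcal U$ refines $\mathcal V$, with the property that, for every open cover $\mathcal U$, $\mathring r(\mathcal U)$ is a closure-preserving family and $$X\setminus\bigcup\mathring r(\mathcal U)\subseteq E_\tau .$$ If $E_\tau=\emptyset$, then $\mathring r$ is a convex monotone open closure-preserving operator.
   Context: A GO-space $(X,\tau,<)$ is a linearly ordered set $(X,<)$ with a Hausdorff topology $\tau$ having a base of order-convex sets. $E_\tau$ denotes the set of all $x\in X$ such that neither $[x,\to)=\{y\in X: y\ge x\}$ nor $(\leftarrow,x]=\{y\in X:y\le x\}$ is $\tau$-open. A family $\mathcal A$ (not necessarily a cover) refines a family $\mathcal B$ if every $A\in\mathcal A$ is contained in some $B\in\mathcal B$. A family $\mathcal F$ of subsets of $X$ is closure-preserving if $\overline{\bigcup\mathcal H}=\bigcup\{\overline H:H\in\mathcal H\}$ for every $\mathcal H\subseteq\mathcal F$. A monotone closure-preserving operator for $X$ is a function $r$ assigning to every open cover $\mathcal U$ of $X$ a closure-preserving cover $r(\mathcal U)$ of $X$ (by arbitrary subsets) that refines $\mathcal U$, such that whenever $\mathcal U,\mathcal V$ are open covers and $\mathcal U$ refines $\mathcal V$, then $r(\mathcal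 U)$ refines $r(\mathcal V)$. It is open (respectively convex) if all members of all $r(\mathcal U)$ are open (respectively order-convex). *)

theory Defs
  imports "HOL-Analysis.Analysis"
begin

text \<open>
  A linearly ordered set is the carrier \<^term>\<open>topspace T\<close> of a topology, an arbitrary (possibly
  empty) subset of a linearly ordered type, with the induced order.  Order-theoretic
  notions are therefore taken relative to the carrier.
\<close>

definition order_convex_in :: "'a::linorder set \<Rightarrow> 'a set \<Rightarrow> bool" where
  "order_convex_in X C \<longleftrightarrow>
     C \<subseteq> X \<and> (\<forall>a\<in>C. \<forall>b\<in>C. \<forall>x\<in>X. a \<le> x \<and> x \<le> b \<longrightarrow> x \<in> C)"

definition GO_space :: "'a::linorder topology \<Rightarrow> bool" where
  "GO_space T \<longleftrightarrow> Hausdorff_space T \<and>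
     (\<exists>\<B>. (\<forall>B\<in>\<B>. openin T B \<and> order_convex_in (topspace T) B) \<and>
          (\<forall>U x. openin T U \<and> x \<in> U \<longrightarrow> (\<exists>B\<in>\<B>. x \<in> B \<and> B \<subseteq> U)))"

definition E_set :: "'a::linorder topology \<Rightarrow> 'a set" where
  "E_set T = {x \<in> topspace T. \<not> openin T {y \<in> topspace T. x \<le> y} \<and>
                              \<not> openin T {y \<in> topspace T. y \<le> x}}"

definition refines :: "'a set set \<Rightarrow> 'a set set \<Rightarrow> bool" where
  "refines \<A> \<B> \<longleftrightarrow> (\<forall>A\<in>\<A>. \<exists>B\<in>\<B>. A \<subseteq> B)"

definition open_cover :: "'a topology \<Rightarrow> 'a set set \<Rightarrow> bool" where
  "open_cover T \<U> \<longleftrightarrow> (\<forall>U\<in>\<U>. openin T U) \<and> \<Union>\<U> = topspace T"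

definition closure_preserving :: "'a topology \<Rightarrow> 'a set set \<Rightarrow> bool" where
  "closure_preserving T \<F> \<longleftrightarrow>
     (\<forall>\<H>\<subseteq>\<F>. T closure_of (\<Union>\<H>) = (\<Union>H\<in>\<H>. T closure_of H))"

text \<open>
  Operators are total functions on families of sets; only their values on open covers matter.
  A monotone operator need not produce covers.
\<close>

definition monotone_operator :: "'a topology \<Rightarrow> ('a set set \<Rightarrow> 'a set set) \<Rightarrow> bool" where
  "monotone_operator T r \<longleftrightarrow>
     (\<forall>\<U>. open_cover T \<U> \<longrightarrow> refines (r \<U>) \<U>) \<and>
     (\<forall>\<U> \<V>. open_cover T \<U> \<and> open_cover T \<V> \<and> refines \<U> \<V> \<longrightarrow> refines (r \<U>) (r \<V>))"

definition open_operator :: "'a topology \<Rightarrow> ('a set set \<Rightarrow> 'a set set) \<Rightarrow> bool" where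
  "open_operator T r \<longleftrightarrow> (\<forall>\<U>. open_cover T \<U> \<longrightarrow> (\<forall>A\<in>r \<U>. openin T A))"

definition convex_operator :: "'a::linorder topology \<Rightarrow> ('a set set \<Rightarrow> 'a set set) \<Rightarrow> bool" where
  "convex_operator T r \<longleftrightarrow>
     (\<forall>\<U>. open_cover T \<U> \<longrightarrow> (\<forall>A\<in>r \<U>. order_convex_in (topspace T) A))"

definition monotone_closure_preserving_operator ::
    "'a topology \<Rightarrow> ('a set set \<Rightarrow> 'a set set) \<Rightarrow> bool" where
  "monotone_closure_preserving_operator T r \<longleftrightarrow> monotone_operator T r \<and>
     (\<forall>\<U>. open_cover T \<U> \<longrightarrow> \<Union>(r \<U>) = topspace T \<and> closure_preserving T (r \<U>))"

end

theory Submission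
  imports Defs
begin

text \<open>
  Shrink an open cover \<open>\<U>\<close> to the family \<open>\<U>'\<close> of all convex open sets whose closure lies in a
  member of \<open>\<U>\<close>; this is a cover because GO-spaces are regular, and it depends monotonically on
  \<open>\<U>\<close>.  Put \<open>r' \<U> = {int (cl (conv A)) | A \<in> r \<U>'}\<close>.  Convex hulls, closures, and interiors of
  closed convex sets all preserve the closure-preserving property: if \<open>conv A\<close> meets a convex
  neighbourhood of \<open>x\<close> but omits \<open>x\<close>, then \<open>A\<close> itself meets it, and a convex set containing
  \<open>x\<close> and some \<open>c > x\<close> has \<open>(x,c)\<close> in its interior.  The sets \<open>cl (conv A)\<close> cover.
  If \<open>[x,\<rightarrow>)\<close> is open and \<open>x\<close> is not isolated, then \<open>x\<close> is
  in the closure of \<open>(x,\<rightarrow>)\<close>, so closure preservation yields a member of that closed family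
  containing \<open>x\<close> and some \<open>c > x\<close>, hence the open set \<open>[x,c)\<close>; thus \<open>x\<close> is covered by an interior.
\<close>

section \<open>Relative convex hulls and closure-preserving families\<close>

definition convex_hull_in :: "'a::linorder set \<Rightarrow> 'a set \<Rightarrow> 'a set" where
  "convex_hull_in X A = {x \<in> X. \<exists>a\<in>A. \<exists>b\<in>A. a \<le> x \<and> x \<le> b}"

text \<open>Taking every such \<open>V\<close>, without choices, makes the family monotone in
  \<open>\<U>\<close>. Since \<open>V\<close> is convex and its closure lies in a member of
  \<open>\<U>\<close>, the closure of the convex hull of any subset of \<open>V\<close> lies in that
  member too.\<close>

definition convex_shrinking :: "'a::linorder topology \<Rightarrow> 'a set set \<Rightarrow> 'a set set" where
  "convex_shrinking T \<U> =
     {V. openin T V \<and> order_convex_in (topspace T) V \<and> (\<exists>U\<in>\<U>. T closure_of V \<subseteq> U)}"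

lemma order_convex_inD:
  "\<lbrakk>order_convex_in X C; a \<in> C; b \<in> C; x \<in> X; a \<le> x; x \<le> b\<rbrakk> \<Longrightarrow> x \<in> C"
  unfolding order_convex_in_def by blast

lemma order_convex_in_subset: "order_convex_in X C \<Longrightarrow> C \<subseteq> X"
  unfolding order_convex_in_def by blast

lemma order_convex_in_hull: "order_convex_in X (convex_hull_in X A)"
  unfolding order_convex_in_def convex_hull_in_def by (auto intro: order_trans)

lemma hull_increasing: "A \<subseteq> X \<Longrightarrow> A \<subseteq> convex_hull_in X A"
  unfolding convex_hull_in_def by blast

lemma hull_mono: "A \<subseteq> B \<Longrightarrow> convex_hull_in X A \<subseteq> convex_hull_in X B"
  unfolding convex_hull_in_def by blast

lemma hull_least: "\<lbrakk>A \<subseteq> C; order_convex_in X C\<rbrakk> \<Longrightarrow> convex_hull_in X A \<subseteq> C"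
  unfolding convex_hull_in_def order_convex_in_def by blast

lemma closure_preservingI:
  assumes "\<And>\<H> x. \<lbrakk>\<H> \<subseteq> \<F>; x \<in> T closure_of \<Union>\<H>\<rbrakk> \<Longrightarrow> \<exists>H\<in>\<H>. x \<in> T closure_of H"
  shows "closure_preserving T \<F>"
  unfolding closure_preserving_def
proof (intro allI impI subset_antisym)
  fix \<H> assume "\<H> \<subseteq> \<F>"
  then show "T closure_of \<Union>\<H> \<subseteq> (\<Union>H\<in>\<H>. T closure_of H)"
    using assms by auto
  show "(\<Union>H\<in>\<H>. T closure_of H) \<subseteq> T closure_of \<Union>\<H>"
    by (meson SUP_least Union_upper closure_of_mono)
qed

lemma closure_preservingD:
  "\<lbrakk>closure_preserving T \<F>; \<H> \<subseteq> \<F>; x \<in> T closure_of \<Union>\<H>\<rbrakk> \<Longrightarrow> \<exists>H\<in>\<H>. x \<in> T closure_of H"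
  unfolding closure_preserving_def by blast

text \<open>The closures of the sets in a subfamily unite to the closure of the subfamily's union.
  This is already closed, so closing again adds no point.\<close>

lemma closure_preserving_closures:
  assumes "closure_preserving T \<F>"
  shows "closure_preserving T ((closure_of) T ` \<F>)"
proof (rule closure_preservingI)
  fix \<H> x
  assume "\<H> \<subseteq> (closure_of) T ` \<F>" and x: "x \<in> T closure_of \<Union>\<H>"
  then obtain \<G> where \<G>: "\<G> \<subseteq> \<F>" "\<H> = (closure_of) T ` \<G>"
    by (auto simp: subset_image_iff)
  have "\<Union>\<H> = T closure_of \<Union>\<G>"
    using assms \<G> by (simp add: closure_preserving_def)
  with x have "x \<in> T closure_of \<Union>\<G>"
    by simp
  with closure_preservingD[OF assms \<G>(1)] show "\<exists>H\<in>\<H>. x \<in> T closure_of H"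
    by (auto simp: \<G>(2))
qed

section \<open>Rays, convex sets and regularity in GO-spaces\<close>

lemma GO_space_convex_neighbourhood:
  assumes "GO_space T" "openin T U" "x \<in> U"
  obtains B where "openin T B" "order_convex_in (topspace T) B" "x \<in> B" "B \<subseteq> U"
proof -
  obtain \<B> where \<B>: "\<forall>B\<in>\<B>. openin T B \<and> order_convex_in (topspace T) B"
      and base: "\<forall>U x. openin T U \<and> x \<in> U \<longrightarrow> (\<exists>B\<in>\<B>. x \<in> B \<and> B \<subseteq> U)"
    using assms(1) unfolding GO_space_def by blast
  obtain B where "B \<in> \<B>" "x \<in> B" "B \<subseteq> U"
    using base assms(2,3) by blast
  with \<B> that show thesis by blast
qed

text \<open>By the Hausdorff property, each \<open>y \<noteq> p\<close> has a convex open
  neighbourhood missing \<open>p\<close>; it cannot reach across \<open>p\<close>, so it stays on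
  the side of \<open>y\<close>.\<close>

lemma GO_space_openin_rays:
  assumes "GO_space T" "p \<in> topspace T"
  shows "openin T {y \<in> topspace T. y < p}" "openin T {y \<in> topspace T. p < y}"
proof -
  have sep: "\<forall>x y. x \<in> topspace T \<and> y \<in> topspace T \<and> x \<noteq> y \<longrightarrow>
      (\<exists>U V. openin T U \<and> openin T V \<and> x \<in> U \<and> y \<in> V \<and> disjnt U V)"
    using assms(1) by (simp add: GO_space_def Hausdorff_space_def)
  have *: "\<exists>B. openin T B \<and> order_convex_in (topspace T) B \<and> y \<in> B \<and> p \<notin> B"
    if y: "y \<in> topspace T" "y \<noteq> p" for y
  proof -
    obtain U V where "openin T U" "y \<in> U" "p \<in> V" "disjnt U V"
      using sep[rule_format, OF conjI[OF y(1) conjI[OF assms(2) y(2)]]] by blast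
    moreover obtain B where "openin T B" "order_convex_in (topspace T) B" "y \<in> B" "B \<subseteq> U"
      using GO_space_convex_neighbourhood[OF assms(1) \<open>openin T U\<close> \<open>y \<in> U\<close>] .
    ultimately show ?thesis
      by (intro exI[of _ B]) (auto simp: disjnt_iff)
  qed
  show "openin T {y \<in> topspace T. y < p}"
  proof (subst openin_subopen, rule ballI)
    fix y assume y: "y \<in> {y \<in> topspace T. y < p}"
    then obtain B where B: "openin T B" "order_convex_in (topspace T) B" "y \<in> B" "p \<notin> B"
      using * by blast
    have "B \<subseteq> {y \<in> topspace T. y < p}"
      using B y order_convex_inD[OF B(2,3) _ assms(2)] openin_subset[OF B(1)] by force
    with B show "\<exists>S. openin T S \<and> y \<in> S \<and> S \<subseteq> {y \<in> topspace T. y < p}"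
      by blast
  qed
  show "openin T {y \<in> topspace T. p < y}"
  proof (subst openin_subopen, rule ballI)
    fix y assume y: "y \<in> {y \<in> topspace T. p < y}"
    then obtain B where B: "openin T B" "order_convex_in (topspace T) B" "y \<in> B" "p \<notin> B"
      using * by blast
    have "B \<subseteq> {y \<in> topspace T. p < y}"
      using B y order_convex_inD[OF B(2) _ B(3) assms(2)] openin_subset[OF B(1)] by force
    with B show "\<exists>S. openin T S \<and> y \<in> S \<and> S \<subseteq> {y \<in> topspace T. p < y}"
      by blast
  qed
qed

lemma GO_space_closedin_rays:
  assumes "GO_space T" "p \<in> topspace T"
  shows "closedin T {y \<in> topspace T. y \<le> p}" "closedin T {y \<in> topspace T. p \<le> y}"
proof -
  have *: "topspace T - {y \<in> topspace T. p < y} = {y \<in> topspace T. y \<le> p}"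
    "topspace T - {y \<in> topspace T. y < p} = {y \<in> topspace T. p \<le> y}"
    by auto
  note rays = GO_space_openin_rays[OF assms]
  show "closedin T {y \<in> topspace T. y \<le> p}" "closedin T {y \<in> topspace T. p \<le> y}"
    using closedin_diff[OF closedin_topspace rays(2)] closedin_diff[OF closedin_topspace rays(1)]
    unfolding * .
qed

text \<open>The open interval from \<open>a\<close> to \<open>b\<close> is an open subset of
  \<open>C\<close>. Thus a convex set exceeds its interior at most by a least and a greatest
  element.\<close>

lemma convex_interior:
  assumes "GO_space T" "order_convex_in (topspace T) C"
    and "a \<in> C" "b \<in> C" "x \<in> topspace T" "a < x" "x < b"
  shows "x \<in> T interior_of C"
proof -
  let ?I = "{y \<in> topspace T. a < y} \<inter> {y \<in> topspace T. y < b}"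
  have "a \<in> topspace T" "b \<in> topspace T"
    using order_convex_in_subset[OF assms(2)] assms(3,4) by blast+
  then have "openin T ?I"
    using GO_space_openin_rays[OF assms(1)] by blast
  moreover have "?I \<subseteq> C"
    using order_convex_inD[OF assms(2-4)] by auto
  ultimately show ?thesis
    using assms(5-7) unfolding interior_of_def by blast
qed

lemma order_convex_in_interior:
  assumes "GO_space T" "order_convex_in (topspace T) C"
  shows "order_convex_in (topspace T) (T interior_of C)"
  unfolding order_convex_in_def
proof (intro conjI ballI impI)
  fix a b x
  assume "a \<in> T interior_of C" "b \<in> T interior_of C" "x \<in> topspace T" "a \<le> x \<and> x \<le> b"
  then show "x \<in> T interior_of C"
    using convex_interior[OF assms, of a b x] interior_of_subset[of T C]
    by (metis le_less subsetD)
qed (rule interior_of_subset_topspace)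

text \<open>The open rays at a point \<open>x\<close> strictly between two closure points are
  neighbourhoods of these, so \<open>C\<close> has points on both sides of \<open>x\<close> and
  already contains \<open>x\<close>.\<close>

lemma order_convex_in_closure:
  assumes "GO_space T" "order_convex_in (topspace T) C"
  shows "order_convex_in (topspace T) (T closure_of C)"
  unfolding order_convex_in_def
proof (intro conjI ballI impI)
  fix a b x
  assume a: "a \<in> T closure_of C" and b: "b \<in> T closure_of C"
    and x: "x \<in> topspace T" and axb: "a \<le> x \<and> x \<le> b"
  show "x \<in> T closure_of C"
  proof (cases "a = x \<or> b = x")
    case False
    with axb have "a < x" "x < b" by auto
    moreover have "a \<in> topspace T" "b \<in> topspace T"
      using a b by (simp_all add: in_closure_of)
    ultimately have "a \<in> {y \<in> topspace T. y < x}" "b \<in> {y \<in> topspace T. x < y}"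
      by auto
    then obtain c d where "c \<in> C" "c < x" "d \<in> C" "x < d"
      using a b GO_space_openin_rays[OF assms(1) x] unfolding in_closure_of
      by (metis (lifting) mem_Collect_eq)
    then have "x \<in> C"
      using order_convex_inD[OF assms(2) _ _ x] by (meson less_imp_le)
    then show ?thesis
      using x unfolding in_closure_of by blast
  qed (use a b in auto)
qed (rule closure_of_subset_topspace)

text \<open>Inside a convex neighbourhood \<open>B\<close> of \<open>x\<close> the two sides are
  handled separately: an open set around \<open>x\<close> is enclosed in a closed set that does not
  leave \<open>B\<close> on the given side.\<close>

lemma GO_space_regular:
  assumes "GO_space T" "openin T U" "x \<in> U"
  obtains V where "openin T V" "order_convex_in (topspace T) V" "x \<in> V" "T closure_of V \<subseteq> U"
proof -
  let ?X = "topspace T"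
  note rays = GO_space_openin_rays[OF assms(1)] GO_space_closedin_rays[OF assms(1)]
  obtain B where B: "openin T B" "order_convex_in ?X B" "x \<in> B" "B \<subseteq> U"
    using GO_space_convex_neighbourhood[OF assms] .
  note conv = order_convex_inD[OF B(2)]
  have BX: "B \<subseteq> ?X" and x: "x \<in> ?X"
    using B openin_subset by blast+
  \<comment> \<open>The upper side. If \<open>B\<close> has a point \<open>p\<close> above
    \<open>x\<close>, either some \<open>q\<close> lies between them and the rays below
    \<open>q\<close> serve, or \<open>x\<close> and \<open>p\<close> form a jump; otherwise
    \<open>x\<close> is the greatest element of \<open>B\<close>.\<close>
  have "\<exists>R R'. openin T R \<and> closedin T R' \<and> x \<in> R \<and> R \<subseteq> R' \<and> (\<forall>y\<in>R'. x \<le> y \<longrightarrow> y \<in> B)"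
  proof (cases "\<exists>p\<in>B. x < p")
    case True
    then obtain p where p: "p \<in> B" "x < p" by blast
    show ?thesis
    proof (cases "\<exists>q\<in>?X. x < q \<and> q < p")
      case True
      then obtain q where q: "q \<in> ?X" "x < q" "q < p" by blast
      have "openin T {y \<in> ?X. y < q}" "closedin T {y \<in> ?X. y \<le> q}" "x \<in> {y \<in> ?X. y < q}"
        "{y \<in> ?X. y < q} \<subseteq> {y \<in> ?X. y \<le> q}"
        "\<forall>y\<in>{y \<in> ?X. y \<le> q}. x \<le> y \<longrightarrow> y \<in> B"
        using rays[OF q(1)] q x p conv[OF B(3) p(1)] by auto+
      then show ?thesis
        by (intro exI conjI)
    next
      case False
      \<comment> \<open>At a jump the open ray below \<open>p\<close> coincides with the closed ray
        up to \<open>x\<close>.\<close>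
      then have "openin T {y \<in> ?X. y < p}" "closedin T {y \<in> ?X. y \<le> x}" "x \<in> {y \<in> ?X. y < p}"
        "{y \<in> ?X. y < p} \<subseteq> {y \<in> ?X. y \<le> x}"
        "\<forall>y\<in>{y \<in> ?X. y \<le> x}. x \<le> y \<longrightarrow> y \<in> B"
        using rays(1)[of p] rays(3)[OF x] x p BX B(3) by force+
      then show ?thesis
        by (intro exI conjI)
    qed
  next
    case False
    then have "\<forall>y\<in>B. y \<le> x"
      by (simp add: not_less)
    \<comment> \<open>Adding the lower ray to \<open>B\<close> shows that the closed ray up to
      \<open>x\<close> is also open.\<close>
    then have "B \<union> {y \<in> ?X. y < x} = {y \<in> ?X. y \<le> x}"
      using BX B(3) by (auto simp: le_less)
    then have "openin T {y \<in> ?X. y \<le> x}"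
      using B(1) rays(1)[OF x] by (metis openin_Un)
    moreover have "closedin T {y \<in> ?X. y \<le> x}" "x \<in> {y \<in> ?X. y \<le> x}"
      "\<forall>y\<in>{y \<in> ?X. y \<le> x}. x \<le> y \<longrightarrow> y \<in> B"
      using rays(3)[OF x] x B(3) by auto+
    ultimately show ?thesis
      by (intro exI[of _ "{y \<in> ?X. y \<le> x}"] conjI order_refl)
  qed
  then obtain R R' where R: "openin T R" "closedin T R'" "x \<in> R" "R \<subseteq> R'"
      "\<And>y. \<lbrakk>y \<in> R'; x \<le> y\<rbrakk> \<Longrightarrow> y \<in> B"
    by blast
  \<comment> \<open>The lower side, by the mirror image of the same three cases.\<close>
  have "\<exists>L L'. openin T L \<and> closedin T L' \<and> x \<in> L \<and> L \<subseteq> L' \<and> (\<forall>y\<in>L'. y \<le> x \<longrightarrow> y \<in> B)"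
  proof (cases "\<exists>p\<in>B. p < x")
    case True
    then obtain p where p: "p \<in> B" "p < x" by blast
    show ?thesis
    proof (cases "\<exists>q\<in>?X. p < q \<and> q < x")
      case True
      then obtain q where q: "q \<in> ?X" "p < q" "q < x" by blast
      have "openin T {y \<in> ?X. q < y}" "closedin T {y \<in> ?X. q \<le> y}" "x \<in> {y \<in> ?X. q < y}"
        "{y \<in> ?X. q < y} \<subseteq> {y \<in> ?X. q \<le> y}"
        "\<forall>y\<in>{y \<in> ?X. q \<le> y}. y \<le> x \<longrightarrow> y \<in> B"
        using rays[OF q(1)] q x p conv[OF p(1) B(3)] by auto+
      then show ?thesis
        by (intro exI conjI)
    next
      case False
      then have "openin T {y \<in> ?X. p < y}" "closedin T {y \<in> ?X. x \<le> y}" "x \<in> {y \<in> ?X. p < y}"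
        "{y \<in> ?X. p < y} \<subseteq> {y \<in> ?X. x \<le> y}"
        "\<forall>y\<in>{y \<in> ?X. x \<le> y}. y \<le> x \<longrightarrow> y \<in> B"
        using rays(2)[of p] rays(4)[OF x] x p BX B(3) by force+
      then show ?thesis
        by (intro exI conjI)
    qed
  next
    case False
    then have "\<forall>y\<in>B. x \<le> y"
      by (simp add: not_less)
    then have "B \<union> {y \<in> ?X. x < y} = {y \<in> ?X. x \<le> y}"
      using BX B(3) by (auto simp: le_less)
    then have "openin T {y \<in> ?X. x \<le> y}"
      using B(1) rays(2)[OF x] by (metis openin_Un)
    moreover have "closedin T {y \<in> ?X. x \<le> y}" "x \<in> {y \<in> ?X. x \<le> y}"
      "\<forall>y\<in>{y \<in> ?X. x \<le> y}. y \<le> x \<longrightarrow> y \<in> B"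
      using rays(4)[OF x] x B(3) by auto+
    ultimately show ?thesis
      by (intro exI[of _ "{y \<in> ?X. x \<le> y}"] conjI order_refl)
  qed
  then obtain L L' where L: "openin T L" "closedin T L'" "x \<in> L" "L \<subseteq> L'"
      "\<And>y. \<lbrakk>y \<in> L'; y \<le> x\<rbrakk> \<Longrightarrow> y \<in> B"
    by blast
  have "openin T (R \<inter> L)" "x \<in> R \<inter> L"
    using R L by auto
  then obtain V where V: "openin T V" "order_convex_in ?X V" "x \<in> V" "V \<subseteq> R \<inter> L"
    using GO_space_convex_neighbourhood[OF assms(1)] by blast
  have "T closure_of V \<subseteq> R' \<inter> L'"
    using V(4) R(2,4) L(2,4) by (intro closure_of_minimal) auto
  \<comment> \<open>Every point of \<open>R' \<inter> L'\<close> is comparable with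
    \<open>x\<close>, so one of the two one-sided bounds places it in \<open>B\<close>.\<close>
  also have "\<dots> \<subseteq> U"
    using R(5) L(5) B(4) by (meson IntE linear subsetD subsetI)
  finally show thesis
    using V that by blast
qed

section \<open>Closure preservation under hulls and interiors\<close>

lemma closure_preserving_convex_hulls:
  assumes "GO_space T" "closure_preserving T \<F>" "\<Union>\<F> \<subseteq> topspace T"
  shows "closure_preserving T (convex_hull_in (topspace T) ` \<F>)"
proof (rule closure_preservingI)
  let ?hull = "convex_hull_in (topspace T)"
  fix \<H> x
  assume "\<H> \<subseteq> ?hull ` \<F>" and x: "x \<in> T closure_of \<Union>\<H>"
  then obtain \<G> where \<G>: "\<G> \<subseteq> \<F>" "\<H> = ?hull ` \<G>"
    by (auto simp: subset_image_iff)
  have incr: "A \<subseteq> ?hull A" if "A \<in> \<G>" for A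
    using assms(3) \<G>(1) that by (intro hull_increasing) auto
  have xX: "x \<in> topspace T"
    using x by (simp add: in_closure_of)
  show "\<exists>H\<in>\<H>. x \<in> T closure_of H"
  proof (cases "\<exists>A\<in>\<G>. x \<in> ?hull A")
    case True
    then show ?thesis
      using xX \<G>(2) unfolding in_closure_of by blast
  next
    case False
    \<comment> \<open>When no hull contains \<open>x\<close>, passing to hulls adds no new way to
      approach \<open>x\<close>: the original sets already accumulate there.\<close>
    have "x \<in> T closure_of \<Union>\<G>"
      unfolding in_closure_of
    proof (intro conjI allI impI xX)
      fix U assume "x \<in> U \<and> openin T U"
      then obtain B where B: "openin T B" "order_convex_in (topspace T) B" "x \<in> B" "B \<subseteq> U"
        using GO_space_convex_neighbourhood[OF assms(1)] by metis
      then obtain z A where z: "z \<in> B" "A \<in> \<G>" "z \<in> ?hull A"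
        using x \<G>(2) unfolding in_closure_of by blast
      then obtain a b where ab: "a \<in> A" "b \<in> A" "a \<le> z" "z \<le> b"
        unfolding convex_hull_in_def by blast
      have abX: "a \<in> topspace T" "b \<in> topspace T"
        using ab z(2) \<G>(1) assms(3) by blast+
      \<comment> \<open>As \<open>x\<close> is outside the hull, \<open>a\<close> and
        \<open>b\<close> lie on the same side of it. The nearer one lies between \<open>x\<close>
        and \<open>z\<close>, hence in the convex set \<open>B\<close>.\<close>
      have "x < a \<or> b < x"
        using False z(2) ab(1,2) xX unfolding convex_hull_in_def by force
      then have "a \<in> B \<or> b \<in> B"
        using order_convex_inD[OF B(2,3) z(1) abX(1)] order_convex_inD[OF B(2) z(1) B(3) abX(2)] ab
        by (meson less_imp_le)
      then show "\<exists>y. y \<in> \<Union>\<G> \<and> y \<in> U"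
        using ab z(2) B(4) by blast
    qed
    then obtain A where "A \<in> \<G>" "x \<in> T closure_of A"
      using closure_preservingD[OF assms(2) \<G>(1)] by blast
    then show ?thesis
      using incr closure_of_mono \<G>(2) by blast
  qed
qed

text \<open>Compare \<open>y\<close> and \<open>z\<close>. If \<open>z\<close> is no farther from
  \<open>x\<close> than \<open>y\<close>, it lies between two points of \<open>B\<close>; otherwise
  \<open>y\<close> is strictly between the points \<open>x\<close> and \<open>z\<close> of
  \<open>C\<close>. Either way \<open>B\<close> meets the interior of \<open>C\<close>.\<close>

lemma same_side_interior:
  assumes "GO_space T" "order_convex_in (topspace T) B" "order_convex_in (topspace T) C"
    and "x \<in> B" "y \<in> B" "x \<in> C" "z \<in> T interior_of C"
    and "x < y \<and> x < z \<or> y < x \<and> z < x"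
  shows "z \<in> B \<or> y \<in> T interior_of C"
proof -
  have "z \<in> C" "z \<in> topspace T" "y \<in> topspace T"
    using order_convex_in_subset[OF assms(2)] order_convex_in_subset[OF assms(3)]
      assms(5,7) interior_of_subset[of T C] by blast+
  then show ?thesis
    using assms(8) order_convex_inD[OF assms(2,4,5)] order_convex_inD[OF assms(2,5,4)]
      convex_interior[OF assms(1,3,6), of z y] convex_interior[OF assms(1,3) _ assms(6), of z y]
    by (meson less_imp_le not_le)
qed

text \<open>A closure point outside all the interiors is approached from one side. A closed convex
  \<open>C\<close> that contains \<open>x\<close> and has an interior point on that side has
  interior points arbitrarily near \<open>x\<close>.\<close>

lemma closure_preserving_interiors:
  assumes "GO_space T" "closure_preserving T \<F>"
    and "\<And>C. C \<in> \<F> \<Longrightarrow> closedin T C \<and> order_convex_in (topspace T) C"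
  shows "closure_preserving T ((interior_of) T ` \<F>)"
proof (rule closure_preservingI)
  fix \<H> x
  assume "\<H> \<subseteq> (interior_of) T ` \<F>" and x: "x \<in> T closure_of \<Union>\<H>"
  then obtain \<G> where \<G>: "\<G> \<subseteq> \<F>" "\<H> = (interior_of) T ` \<G>"
    by (auto simp: subset_image_iff)
  have xX: "x \<in> topspace T"
    using x by (simp add: in_closure_of)
  have side: "\<exists>C\<in>\<G>. x \<in> T closure_of (T interior_of C)"
    if xS: "x \<in> T closure_of (\<Union>\<H> \<inter> S)" and S: "S = {x<..} \<or> S = {..<x}" for S
  proof -
    \<comment> \<open>This restriction guarantees that the member returned by closure preservation
      has an interior point on the side \<open>S\<close>.\<close>
    let ?\<G> = "{C \<in> \<G>. T interior_of C \<inter> S \<noteq> {}}"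
    have "\<Union>\<H> \<inter> S \<subseteq> \<Union>?\<G>"
      using \<G>(2) interior_of_subset by fastforce
    then have "x \<in> T closure_of \<Union>?\<G>"
      using xS closure_of_mono by blast
    then obtain C where C: "C \<in> \<G>" "T interior_of C \<inter> S \<noteq> {}" "x \<in> T closure_of C"
      using closure_preservingD[OF assms(2), of ?\<G>] \<G>(1) by blast
    then obtain z where z: "z \<in> T interior_of C" "z \<in> S"
      by blast
    have convC: "order_convex_in (topspace T) C" and xC: "x \<in> C"
      using assms(3) C \<G>(1) by (auto simp: closure_of_closedin)
    have "x \<in> T closure_of (T interior_of C)"
      unfolding in_closure_of
    proof (intro conjI allI impI xX)
      fix U assume "x \<in> U \<and> openin T U"
      then obtain B where B: "openin T B" "order_convex_in (topspace T) B" "x \<in> B" "B \<subseteq> U"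
        using GO_space_convex_neighbourhood[OF assms(1)] by metis
      then obtain y where y: "y \<in> B" "y \<in> S"
        using xS unfolding in_closure_of by blast
      have "z \<in> B \<or> y \<in> T interior_of C"
        using same_side_interior[OF assms(1) B(2) convC B(3) y(1) xC z(1)] S y z by auto
      then show "\<exists>y. y \<in> T interior_of C \<and> y \<in> U"
        using y z B(4) by blast
    qed
    then show ?thesis
      using C(1) by blast
  qed
  show "\<exists>H\<in>\<H>. x \<in> T closure_of H"
  proof (cases "x \<in> \<Union>\<H>")
    case True
    then show ?thesis
      using xX unfolding in_closure_of by blast
  next
    case False
    then have "y < x \<or> x < y" if "y \<in> \<Union>\<H>" for y
      using that by (metis linorder_neqE)
    \<comment> \<open>The closure of a union of two sets is the union of their closures, so one of
      the sides accumulates at \<open>x\<close>.\<close>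
    then have "\<Union>\<H> = (\<Union>\<H> \<inter> {x<..}) \<union> (\<Union>\<H> \<inter> {..<x})"
      by blast
    then have "x \<in> T closure_of (\<Union>\<H> \<inter> {x<..}) \<or> x \<in> T closure_of (\<Union>\<H> \<inter> {..<x})"
      using x by (metis closure_of_Un Un_iff)
    then show ?thesis
      using side \<G>(2) by blast
  qed
qed

section \<open>Points missed by all interiors\<close>

lemma interiors_cover_outside_E_set:
  assumes "GO_space T" "closure_preserving T \<F>" "\<Union>\<F> = topspace T"
    and "\<And>C. C \<in> \<F> \<Longrightarrow> closedin T C \<and> order_convex_in (topspace T) C"
  shows "topspace T - \<Union>((interior_of) T ` \<F>) \<subseteq> E_set T"
proof
  let ?X = "topspace T"
  fix x assume "x \<in> ?X - \<Union>((interior_of) T ` \<F>)"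
  then have x: "x \<in> ?X" and nint: "\<And>C. C \<in> \<F> \<Longrightarrow> x \<notin> T interior_of C"
    by auto
  \<comment> \<open>Here \<open>S\<close> stands for a strict ray at \<open>x\<close>; openness of
    \<open>insert x S\<close> then contradicts one of the two conditions defining
    \<open>E_set\<close>.\<close>
  have reach: "\<exists>C\<in>\<F>. x \<in> C \<and> C \<inter> S \<noteq> {}"
    if "openin T (insert x S)" "S \<subseteq> ?X" for S
  proof -
    have niso: "\<not> openin T {x}"
    proof
      assume "openin T {x}"
      moreover obtain C where "C \<in> \<F>" "x \<in> C" using x assms(3) by auto
      ultimately show False
        using nint[of C] unfolding interior_of_def by blast
    qed
    have "x \<in> T closure_of S"
      unfolding in_closure_of
    proof (intro conjI allI impI x)
      fix U assume U: "x \<in> U \<and> openin T U"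
      \<comment> \<open>If \<open>U\<close> missed \<open>S\<close>, this open set would be
        \<open>{x}\<close>, but \<open>x\<close> is not isolated.\<close>
      then have "openin T (U \<inter> insert x S)"
        using that by blast
      with U niso show "\<exists>y. y \<in> S \<and> y \<in> U"
        by (metis (no_types, lifting) Int_insert_right_if1 disjoint_iff)
    qed
    \<comment> \<open>Only members meeting \<open>S\<close> are needed to cover it, so closure
      preservation yields a closed set that meets \<open>S\<close> and contains
      \<open>x\<close>.\<close>
    moreover have "S \<subseteq> \<Union>{C \<in> \<F>. C \<inter> S \<noteq> {}}"
      using that(2) assms(3) by blast
    ultimately have "x \<in> T closure_of \<Union>{C \<in> \<F>. C \<inter> S \<noteq> {}}"
      using closure_of_mono by blast
    from closure_preservingD[OF assms(2) _ this]
    obtain C where "C \<in> \<F>" "C \<inter> S \<noteq> {}" "x \<in> T closure_of C"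
      by blast
    then show ?thesis
      using assms(4) closure_of_closedin by metis
  qed
  have "\<not> openin T {y \<in> ?X. x \<le> y}"
  proof
    assume op: "openin T {y \<in> ?X. x \<le> y}"
    have "{y \<in> ?X. x \<le> y} = insert x {y \<in> ?X. x < y}"
      using x by auto
    then obtain C c where C: "C \<in> \<F>" "x \<in> C" "c \<in> C" "x < c" "c \<in> ?X"
      using reach[of "{y \<in> ?X. x < y}"] op by auto
    let ?I = "{y \<in> ?X. x \<le> y} \<inter> {y \<in> ?X. y < c}"
    have "openin T ?I" "?I \<subseteq> C" "x \<in> ?I"
      using op GO_space_openin_rays(1)[OF assms(1) C(5)] C x assms(4)[OF C(1)]
        order_convex_inD[of ?X C x c] by auto
    then show False
      using nint[OF C(1)] unfolding interior_of_def by blast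
  qed
  moreover have "\<not> openin T {y \<in> ?X. y \<le> x}"
  proof
    assume op: "openin T {y \<in> ?X. y \<le> x}"
    have "{y \<in> ?X. y \<le> x} = insert x {y \<in> ?X. y < x}"
      using x by auto
    then obtain C c where C: "C \<in> \<F>" "x \<in> C" "c \<in> C" "c < x" "c \<in> ?X"
      using reach[of "{y \<in> ?X. y < x}"] op by auto
    let ?I = "{y \<in> ?X. y \<le> x} \<inter> {y \<in> ?X. c < y}"
    have "openin T ?I" "?I \<subseteq> C" "x \<in> ?I"
      using op GO_space_openin_rays(2)[OF assms(1) C(5)] C x assms(4)[OF C(1)]
        order_convex_inD[of ?X C c x] by auto
    then show False
      using nint[OF C(1)] unfolding interior_of_def by blast
  qed
  ultimately show "x \<in> E_set T"
    using x by (simp add: E_set_def)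
qed

section \<open>The shrunken cover and the resulting operator\<close>

lemma open_cover_convex_shrinking:
  assumes "GO_space T" "open_cover T \<U>"
  shows "open_cover T (convex_shrinking T \<U>)"
  unfolding open_cover_def
proof
  show "\<forall>V\<in>convex_shrinking T \<U>. openin T V"
    by (simp add: convex_shrinking_def)
  show "\<Union>(convex_shrinking T \<U>) = topspace T"
  proof
    show "\<Union>(convex_shrinking T \<U>) \<subseteq> topspace T"
      by (auto simp: convex_shrinking_def dest: openin_subset)
    show "topspace T \<subseteq> \<Union>(convex_shrinking T \<U>)"
    proof
      fix x assume "x \<in> topspace T"
      then obtain U where "U \<in> \<U>" "openin T U" "x \<in> U"
        using assms(2) unfolding open_cover_def by blast
      obtain V where "openin T V" "order_convex_in (topspace T) V" "x \<in> V" "T closure_of V \<subseteq> U"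
        using GO_space_regular[OF assms(1) \<open>openin T U\<close> \<open>x \<in> U\<close>] .
      with \<open>U \<in> \<U>\<close> show "x \<in> \<Union>(convex_shrinking T \<U>)"
        unfolding convex_shrinking_def by blast
    qed
  qed
qed

lemma convex_shrinking_mono:
  assumes "refines \<U> \<V>"
  shows "convex_shrinking T \<U> \<subseteq> convex_shrinking T \<V>"
proof
  fix W assume W: "W \<in> convex_shrinking T \<U>"
  then obtain U where U: "U \<in> \<U>" "T closure_of W \<subseteq> U"
    unfolding convex_shrinking_def by auto
  obtain V where "V \<in> \<V>" "U \<subseteq> V"
    using assms U(1) unfolding refines_def by auto
  with U(2) have "\<exists>V\<in>\<V>. T closure_of W \<subseteq> V"
    by (meson subset_trans)
  with W show "W \<in> convex_shrinking T \<V>"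
    unfolding convex_shrinking_def by simp
qed

theorem theorem3p10:
  fixes T :: "'a::linorder topology"
    and r :: "'a set set \<Rightarrow> 'a set set"
  assumes "GO_space T"
    and "monotone_closure_preserving_operator T r"
  shows "\<exists>r' :: 'a set set \<Rightarrow> 'a set set.
           monotone_operator T r' \<and> open_operator T r' \<and> convex_operator T r' \<and>
           (\<forall>\<U>. open_cover T \<U> \<longrightarrow>
              closure_preserving T (r' \<U>) \<and> topspace T - \<Union>(r' \<U>) \<subseteq> E_set T) \<and>
           (E_set T = {} \<longrightarrow>
              monotone_closure_preserving_operator T r' \<and> open_operator T r' \<and> convex_operator T r')"
proof -
  define conv where "conv = convex_hull_in (topspace T)"
  \<comment> \<open>The cover is shrunk before \<open>r\<close> is applied because hulls and
    closures enlarge the members afterwards; the shrinking leaves room for both.\<close>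
  define \<F> where "\<F> \<U> = (closure_of) T ` conv ` r (convex_shrinking T \<U>)" for \<U>
  define r' where "r' \<U> = (interior_of) T ` \<F> \<U>" for \<U>
  have r_mono: "refines (r \<U>) (r \<V>)"
    if "open_cover T \<U>" "open_cover T \<V>" "refines \<U> \<V>" for \<U> \<V>
    using assms(2) that
    unfolding monotone_closure_preserving_operator_def monotone_operator_def by blast
  have r_shrink: "refines (r (convex_shrinking T \<U>)) (convex_shrinking T \<U>)"
      "\<Union>(r (convex_shrinking T \<U>)) = topspace T"
      "closure_preserving T (r (convex_shrinking T \<U>))" if "open_cover T \<U>" for \<U>
    using assms(2) open_cover_convex_shrinking[OF assms(1) that]
    unfolding monotone_closure_preserving_operator_def monotone_operator_def by blast+
  have \<F>_closed_convex: "closedin T C \<and> order_convex_in (topspace T) C" if "C \<in> \<F> \<U>" for C \<U>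
    using that order_convex_in_closure[OF assms(1) order_convex_in_hull]
    unfolding \<F>_def conv_def by auto
  have \<F>_cp: "closure_preserving T (\<F> \<U>)" if "open_cover T \<U>" for \<U>
    unfolding \<F>_def conv_def using r_shrink[OF that]
    by (intro closure_preserving_closures closure_preserving_convex_hulls assms(1)) auto
  have \<F>_cover: "\<Union>(\<F> \<U>) = topspace T" if cover: "open_cover T \<U>" for \<U>
  proof
    show "\<Union>(\<F> \<U>) \<subseteq> topspace T"
      using \<F>_closed_convex closedin_subset by blast
    have *: "A \<subseteq> T closure_of (conv A)" if "A \<subseteq> topspace T" for A
    proof -
      have "A \<subseteq> conv A" "conv A \<subseteq> topspace T"
        using hull_increasing[OF that] by (auto simp: conv_def convex_hull_in_def)
      then show ?thesis
        using closure_of_subset by blast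
    qed
    show "topspace T \<subseteq> \<Union>(\<F> \<U>)"
    proof
      fix x assume "x \<in> topspace T"
      then obtain A where A: "A \<in> r (convex_shrinking T \<U>)" "x \<in> A"
        using r_shrink(2)[OF cover] by auto
      then have "x \<in> T closure_of (conv A)"
        using *[of A] r_shrink(2)[OF cover] by auto
      with A(1) show "x \<in> \<Union>(\<F> \<U>)"
        unfolding \<F>_def by auto
    qed
  qed
  have mono: "monotone_operator T r'"
    unfolding monotone_operator_def
  proof (intro conjI allI impI)
    fix \<U> assume \<U>: "open_cover T \<U>"
    show "refines (r' \<U>) \<U>"
      unfolding refines_def
    proof
      fix W assume "W \<in> r' \<U>"
      then obtain A where A: "A \<in> r (convex_shrinking T \<U>)"
          "W = T interior_of (T closure_of (conv A))"
        unfolding r'_def \<F>_def by blast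
      \<comment> \<open>The set \<open>V\<close> absorbs the hull of \<open>A\<close> by convexity,
        and its closure in \<open>U\<close> absorbs the closure of that hull.\<close>
      then obtain V U where V: "A \<subseteq> V" "order_convex_in (topspace T) V"
          "U \<in> \<U>" "T closure_of V \<subseteq> U"
        using r_shrink(1)[OF \<U>] unfolding refines_def convex_shrinking_def by blast
      have "W \<subseteq> T closure_of (conv A)"
        using A(2) interior_of_subset by metis
      also have "\<dots> \<subseteq> T closure_of V"
        using hull_least[OF V(1,2)] by (simp add: conv_def closure_of_mono)
      finally show "\<exists>U\<in>\<U>. W \<subseteq> U"
        using V(3,4) by blast
    qed
  next
    fix \<U> \<V> assume "open_cover T \<U> \<and> open_cover T \<V> \<and> refines \<U> \<V>"
    \<comment> \<open>The shrunken families are nested, hence one refines the other and monotonicity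
      of \<open>r\<close> applies. Hull, closure and interior then preserve each inclusion between
      members.\<close>
    then have *: "refines (r (convex_shrinking T \<U>)) (r (convex_shrinking T \<V>))"
      using convex_shrinking_mono[of \<U> \<V> T]
      by (intro r_mono open_cover_convex_shrinking assms(1)) (auto simp: refines_def)
    have "T interior_of (T closure_of (conv A)) \<subseteq> T interior_of (T closure_of (conv B))"
      if "A \<subseteq> B" for A B
      using that unfolding conv_def by (intro interior_of_mono closure_of_mono hull_mono)
    with * show "refines (r' \<U>) (r' \<V>)"
      unfolding refines_def r'_def \<F>_def image_image by (simp add: bex_simps) meson
  qed
  have "open": "open_operator T r'"
    by (auto simp: open_operator_def r'_def)
  have convex: "convex_operator T r'"
    using order_convex_in_interior[OF assms(1)] \<F>_closed_convex
    by (auto simp: convex_operator_def r'_def)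
  have cp: "closure_preserving T (r' \<U>)" if "open_cover T \<U>" for \<U>
    unfolding r'_def
    by (rule closure_preserving_interiors[OF assms(1) \<F>_cp[OF that]]) (rule \<F>_closed_convex)
  have E: "topspace T - \<Union>(r' \<U>) \<subseteq> E_set T" if "open_cover T \<U>" for \<U>
    unfolding r'_def
    by (rule interiors_cover_outside_E_set[OF assms(1) \<F>_cp[OF that] \<F>_cover[OF that]])
      (rule \<F>_closed_convex)
  have "\<Union>(r' \<U>) \<subseteq> topspace T" for \<U>
    unfolding r'_def using interior_of_subset_topspace by fastforce
  then have "monotone_closure_preserving_operator T r'" if "E_set T = {}"
    unfolding monotone_closure_preserving_operator_def
    using mono cp E that by (metis Diff_eq_empty_iff subset_antisym subset_empty)
  with mono "open" convex cp E show ?thesis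
    by (intro exI[of _ r'] conjI allI impI)
qed

end
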